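(* Let $W$ be the Weyl group of an irreducible reduced crystallographic root system $R$ of rank $n$ in the Euclidean space $E_n$, and for $\lambda$ in the closed dominant Weyl chamber $D_+$ let $\phi_\lambda(x)=\sum_{\mu\in O(\lambda)}e^{2\pi \mathrm{i}\langle\mu,x\rangle}$, $x\in E_n$, be the corresponding orbit function. Then for every $\lambda\in D_+$, $$\phi_\lambda(wx)=\phi_\lambda(x)\qquad\text{for all } w\in W,\ x\in E_n.$$ Moreover, if $\lambda\in P_+$ is a dominant integral weight, then $\phi_\lambda$ is invariant under the affine Weyl group: $$\phi_\lambda(gx)=\phi_\lambda(x)\qquad\text{for all } g\in W^{\rm aff},\ x\in E_n.$$
   Context: $R$ is an irreducible reduced crystallographic root system spanning the Euclidean space $E_n$ with scalar product $\langle\cdot,\cdot\rangle$, with simple roots $\alpha_1,\dots,\alpha_n$, normalized so that long roots have squared length $2$ (all roots count as long if there is only one length). For a root $\alpha$, $\alpha^\vee=2\alpha/\langle\alpha,\alpha\rangle$ and $r_\alpha x=x-\langle x,\alpha^\vee\rangle\alpha$. $W$ is the group generated by $r_{\alpha_1},\dots,r_{\alpha_n}$. The dominant Weyl chamber is $D_+=\{x\in E_n:\langle x,\alpha_i\rangle\ge 0,\ i=1,\dots,n\}$. The weight lattice is $P=\{\lambda\in E_n:\langle\lambda,\alpha_j^\vee\rangle\in\mathbb Z,\ j=1,\dots,n\}$ and $P_+=P\cap D_+$. $O(\lambda)=\{w\lambda: w\in W\}$ is the $W$-orbit of $\lambda$ (a set of distinct points). Let $\xi$ be the highest root (a long root,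 so $\xi^\vee=\xi$). The affine Weyl group $W^{\rm aff}$ is the group of affine transformations of $E_n$ generated by $r_{\alpha_1},\dots,r_{\alpha_n}$ and the affine reflection $r_0x=r_\xi x+\xi^\vee$. *)

theory Defs
  imports "HOL-Analysis.Analysis" "HOL-Algebra.Generated_Groups" "HOL-Algebra.Bij"
begin

text \<open>
  The ambient Euclidean space $E_n$ is a type of class \<^class>\<open>euclidean_space\<close>, so that $n$
  is its dimension \<open>DIM('a)\<close>.
\<close>

definition coroot :: "'a::euclidean_space \<Rightarrow> 'a" where
  "coroot \<alpha> = (2 / (\<alpha> \<bullet> \<alpha>)) *\<^sub>R \<alpha>"

definition reflection :: "'a::euclidean_space \<Rightarrow> 'a \<Rightarrow> 'a" where
  "reflection \<alpha> x = x - (x \<bullet> coroot \<alpha>) *\<^sub>R \<alpha>"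

definition crystallographic_root_system :: "'a::euclidean_space set \<Rightarrow> bool" where
  "crystallographic_root_system R \<longleftrightarrow>
     finite R \<and> 0 \<notin> R \<and> span R = UNIV \<and>
     (\<forall>\<alpha>\<in>R. reflection \<alpha> ` R = R) \<and>
     (\<forall>\<alpha>\<in>R. \<forall>\<beta>\<in>R. \<beta> \<bullet> coroot \<alpha> \<in> \<int>)"

definition reduced_roots :: "'a::euclidean_space set \<Rightarrow> bool" where
  "reduced_roots R \<longleftrightarrow> (\<forall>\<alpha>\<in>R. \<forall>c. c *\<^sub>R \<alpha> \<in> R \<longrightarrow> c = 1 \<or> c = -1)"

definition irreducible_roots :: "'a::euclidean_space set \<Rightarrow> bool" where
  "irreducible_roots R \<longleftrightarrow>
     R \<noteq> {} \<and>
     \<not> (\<exists>S T. S \<noteq> {} \<and> T \<noteq> {} \<and> R = S \<union> T \<and> S \<inter> T = {} \<and> (\<forall>\<alpha>\<in>S. \<forall>\<beta>\<in>T. \<alpha> \<bullet> \<beta> = 0))"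

text \<open>If all roots have the same length, then every root is long.\<close>

definition long_root :: "'a::euclidean_space set \<Rightarrow> 'a \<Rightarrow> bool" where
  "long_root R \<alpha> \<longleftrightarrow> \<alpha> \<in> R \<and> (\<forall>\<beta>\<in>R. \<beta> \<bullet> \<beta> \<le> \<alpha> \<bullet> \<alpha>)"

definition normalized_roots :: "'a::euclidean_space set \<Rightarrow> bool" where
  "normalized_roots R \<longleftrightarrow> (\<forall>\<alpha>. long_root R \<alpha> \<longrightarrow> \<alpha> \<bullet> \<alpha> = 2)"

definition nonneg_combination :: "'a::euclidean_space set \<Rightarrow> 'a \<Rightarrow> bool" where
  "nonneg_combination \<Delta> v \<longleftrightarrow> (\<exists>c :: 'a \<Rightarrow> nat. v = (\<Sum>\<alpha>\<in>\<Delta>. real (c \<alpha>) *\<^sub>R \<alpha>))"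

text \<open>
  The simple roots $\alpha_1,\dots,\alpha_n$ are given as the set \<open>\<Delta>\<close>; being a basis,
  it has exactly $n$ elements. Their numbering plays no role below.
\<close>

definition simple_roots :: "'a::euclidean_space set \<Rightarrow> 'a set \<Rightarrow> bool" where
  "simple_roots R \<Delta> \<longleftrightarrow>
     \<Delta> \<subseteq> R \<and> independent \<Delta> \<and> span \<Delta> = UNIV \<and>
     (\<forall>\<beta>\<in>R. nonneg_combination \<Delta> \<beta> \<or> nonneg_combination \<Delta> (- \<beta>))"

definition highest_root :: "'a::euclidean_space set \<Rightarrow> 'a set \<Rightarrow> 'a \<Rightarrow> bool" where
  "highest_root R \<Delta> \<xi> \<longleftrightarrow> \<xi> \<in> R \<and> (\<forall>\<beta>\<in>R. nonneg_combination \<Delta> (\<xi> - \<beta>))"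

text \<open>
  \<^term>\<open>BijGroup UNIV\<close> is the group of all bijections of the space under composition. For
  \<^term>\<open>generate\<close> to denote a generated subgroup its generators must be bijections, which
  reflections in nonzero vectors and their composites with translations are.
\<close>

definition weyl_group :: "'a::euclidean_space set \<Rightarrow> ('a \<Rightarrow> 'a) set" where
  "weyl_group \<Delta> = generate (BijGroup UNIV) (reflection ` \<Delta>)"

definition affine_reflection :: "'a::euclidean_space \<Rightarrow> 'a \<Rightarrow> 'a" where
  "affine_reflection \<xi> x = reflection \<xi> x + coroot \<xi>"

definition affine_weyl_group :: "'a::euclidean_space set \<Rightarrow> 'a \<Rightarrow> ('a \<Rightarrow> 'a) set" where
  "affine_weyl_group \<Delta> \<xi> =
     generate (BijGroup UNIV) (insert (affine_reflection \<xi>) (reflection ` \<Delta>))"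

definition dominant_chamber :: "'a::euclidean_space set \<Rightarrow> 'a set" where
  "dominant_chamber \<Delta> = {x. \<forall>\<alpha>\<in>\<Delta>. x \<bullet> \<alpha> \<ge> 0}"

definition weight_lattice :: "'a::euclidean_space set \<Rightarrow> 'a set" where
  "weight_lattice \<Delta> = {x. \<forall>\<alpha>\<in>\<Delta>. x \<bullet> coroot \<alpha> \<in> \<int>}"

definition dominant_weights :: "'a::euclidean_space set \<Rightarrow> 'a set" where
  "dominant_weights \<Delta> = weight_lattice \<Delta> \<inter> dominant_chamber \<Delta>"

definition weyl_orbit :: "'a::euclidean_space set \<Rightarrow> 'a \<Rightarrow> 'a set" where
  "weyl_orbit \<Delta> v = {w v | w. w \<in> weyl_group \<Delta>}"

text \<open>
  The orbit is finite when \<open>\<Delta>\<close> is the set of simple roots of a root system (the Weyl group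
  permutes the finite spanning set of roots), so the sum is a genuine finite sum over distinct
  points.
\<close>

definition orbit_function :: "'a::euclidean_space set \<Rightarrow> 'a \<Rightarrow> 'a \<Rightarrow> complex" where
  "orbit_function \<Delta> v x =
     (\<Sum>\<mu>\<in>weyl_orbit \<Delta> v. exp (2 * of_real pi * \<i> * of_real (\<mu> \<bullet> x)))"

end

theory Submission
  imports Defs
begin

text \<open>
  Reflections are self-adjoint involutions, so the reflection in a root merely permutes the
  exponentials of the orbit sum as soon as it lies in the Weyl group; the translation part of the
  affine reflection disappears as soon as weights pair integrally with all coroots. Both conditions
  are stable under simple reflections and hold for simple roots, hence hold for all roots:
  a positive root that is not simple has a positive scalar product with some simple root, and the
  reflection in the latter gives a positive root of smaller height.
\<close>

section \<open>Induction over subgroups generated by bijections of the space\<close>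

lemma mult_BijGroup_UNIV:
  assumes "bij f" and "bij g"
  shows "f \<otimes>\<^bsub>BijGroup UNIV\<^esub> g = f \<circ> g"
  using assms by (simp add: BijGroup_def Bij_def compose_def fun_eq_iff)

lemma one_BijGroup_UNIV: "\<one>\<^bsub>BijGroup UNIV\<^esub> = id"
  by (simp add: BijGroup_def fun_eq_iff)

lemma inv_BijGroup_UNIV:
  assumes "bij f"
  shows "inv\<^bsub>BijGroup UNIV\<^esub> f = Hilbert_Choice.inv f"
  using inv_BijGroup[of f UNIV] assms by (simp add: Bij_def restrict_def)

text \<open>The operations of \<open>BijGroup UNIV\<close> are known to be composition and
  functional inverse only on bijections. Bijectivity is therefore proved along with
  \<open>P\<close>, which also makes it available in the composition case.\<close>

lemma generate_BijGroup_induct [consumes 2, case_names one incl inv comp]: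
  assumes g: "g \<in> generate (BijGroup UNIV) H" and H: "\<forall>h\<in>H. bij h"
    and one: "P id" and incl: "\<And>h. h \<in> H \<Longrightarrow> P h"
    and inv: "\<And>h. h \<in> H \<Longrightarrow> P (Hilbert_Choice.inv h)"
    and comp: "\<And>g h. bij g \<Longrightarrow> bij h \<Longrightarrow> P g \<Longrightarrow> P h \<Longrightarrow> P (g \<circ> h)"
  shows "P g"
proof -
  have "bij g \<and> P g"
    using g
  proof induction
    case one
    show ?case unfolding one_BijGroup_UNIV using \<open>P id\<close> bij_id by blast
  next
    case (incl h)
    then show ?case using H assms(4) by blast
  next
    case (inv h)
    then show ?case using H assms(5) by (simp add: inv_BijGroup_UNIV bij_imp_bij_inv)
  next
    case (eng g h)
    then show ?case by (metis mult_BijGroup_UNIV bij_comp comp)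
  qed
  then show ?thesis ..
qed

lemma generate_BijGroup_bij:
  assumes "g \<in> generate (BijGroup UNIV) H" and "\<forall>h\<in>H. bij h"
  shows "bij g"
  using assms
proof (induction rule: generate_BijGroup_induct)
  case (comp g h)
  then show ?case by (simp only: bij_comp)
qed (use assms(2) bij_imp_bij_inv bij_id in \<open>auto simp only:\<close>)

text \<open>Reduces both claims of the theorem to generators. The inverse of a generator
  \<open>h\<close> causes no trouble: since h is surjective, x is h applied to its inverse image, so
  invariance under \<open>h\<close> can be read backwards.\<close>

lemma generate_BijGroup_invariant:
  assumes "g \<in> generate (BijGroup UNIV) H" and "\<forall>h\<in>H. bij h"
    and "\<And>h x. h \<in> H \<Longrightarrow> f (h x) = f x"
  shows "f (g x) = f x"
proof -
  have "\<forall>x. f (g x) = f x"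
    using assms(1,2)
  proof (induction rule: generate_BijGroup_induct)
    case (inv h)
    then show ?case
      by (metis assms(2,3) bij_is_surj surj_f_inv_f)
  qed (simp_all add: assms)
  then show ?thesis ..
qed

section \<open>Algebra of reflections and coroots\<close>

lemma linear_reflection: "linear (reflection \<alpha>)"
  unfolding reflection_def by (intro linearI) (simp_all add: algebra_simps)

lemma reflection_self_adjoint: "x \<bullet> reflection \<alpha> y = reflection \<alpha> x \<bullet> y"
  by (simp add: reflection_def coroot_def inner_commute algebra_simps)

lemma reflection_root:
  assumes "\<alpha> \<noteq> 0"
  shows "reflection \<alpha> \<alpha> = - \<alpha>"
proof -
  have "\<alpha> \<bullet> coroot \<alpha> = 2" using assms by (simp add: coroot_def)
  then show ?thesis by (simp add: reflection_def scaleR_2)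
qed

lemma reflection_involutive:
  assumes "\<alpha> \<noteq> 0"
  shows "reflection \<alpha> (reflection \<alpha> x) = x"
proof -
  have "reflection \<alpha> (reflection \<alpha> x) = reflection \<alpha> x - (x \<bullet> coroot \<alpha>) *\<^sub>R reflection \<alpha> \<alpha>"
    by (subst reflection_def[of \<alpha> x])
      (simp add: linear_diff[OF linear_reflection] linear_scale[OF linear_reflection])
  also have "\<dots> = x"
    by (simp add: reflection_root[OF assms]) (simp add: reflection_def)
  finally show ?thesis .
qed

lemma bij_reflection: "\<alpha> \<noteq> 0 \<Longrightarrow> bij (reflection \<alpha>)"
  by (rule involuntory_imp_bij) (simp add: reflection_involutive)

lemma inv_reflection: "\<alpha> \<noteq> 0 \<Longrightarrow> Hilbert_Choice.inv (reflection \<alpha>) = reflection \<alpha>"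
  by (rule inv_unique_comp) (simp_all add: fun_eq_iff reflection_involutive)

text \<open>Being a self-adjoint involution, the reflection preserves squared lengths, hence also
  the scalar factor in the coroot; linearity does the rest.\<close>

lemma coroot_reflection:
  assumes "\<alpha> \<noteq> 0"
  shows "coroot (reflection \<alpha> \<beta>) = reflection \<alpha> (coroot \<beta>)"
  by (simp add: coroot_def linear_scale[OF linear_reflection] reflection_self_adjoint
      reflection_involutive assms)

text \<open>This conjugation formula carries membership in the Weyl group from one root to its image
  under a simple reflection.\<close>

lemma reflection_reflection:
  assumes "\<alpha> \<noteq> 0"
  shows "reflection (reflection \<alpha> \<beta>) = reflection \<alpha> \<circ> reflection \<beta> \<circ> reflection \<alpha>"
proof
  fix x
  have "reflection \<alpha> (reflection \<beta> (reflection \<alpha> x))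
      = reflection \<alpha> (reflection \<alpha> x - (reflection \<alpha> x \<bullet> coroot \<beta>) *\<^sub>R \<beta>)"
    by (simp add: reflection_def[of \<beta>])
  also have "\<dots> = x - (x \<bullet> coroot (reflection \<alpha> \<beta>)) *\<^sub>R reflection \<alpha> \<beta>"
    by (simp add: linear_diff[OF linear_reflection] linear_scale[OF linear_reflection]
        coroot_reflection reflection_involutive reflection_self_adjoint assms)
  finally show "reflection (reflection \<alpha> \<beta>) x = (reflection \<alpha> \<circ> reflection \<beta> \<circ> reflection \<alpha>) x"
    by (simp add: reflection_def[of "reflection \<alpha> \<beta>"])
qed

section \<open>Reaching every root from the simple roots\<close>

lemma independent_sum_eqD:
  assumes "finite B" and "independent B"
    and "(\<Sum>b\<in>B. u b *\<^sub>R b) = (\<Sum>b\<in>B. v b *\<^sub>R b)" and "b \<in> B"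
  shows "u b = v b"
proof -
  have "(\<Sum>b\<in>B. (u b - v b) *\<^sub>R b) = 0"
    using assms(3) by (simp add: scaleR_left_diff_distrib sum_subtractf)
  then have "u b - v b = 0"
    by (rule independentD[OF assms(2,1) subset_refl _ assms(4)])
  then show ?thesis by simp
qed

lemma root_induct [consumes 4, case_names simple reflect]:
  fixes R \<Delta> :: "'a::euclidean_space set"
  assumes R: "crystallographic_root_system R" and red: "reduced_roots R"
    and \<Delta>: "simple_roots R \<Delta>" and "\<beta> \<in> R"
    and simple: "\<And>\<alpha>. \<alpha> \<in> \<Delta> \<Longrightarrow> P \<alpha>"
    and reflect: "\<And>\<alpha> \<beta>. \<alpha> \<in> \<Delta> \<Longrightarrow> \<beta> \<in> R \<Longrightarrow> P \<beta> \<Longrightarrow> P (reflection \<alpha> \<beta>)"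
  shows "P \<beta>"
proof -
  have finR: "finite R" and zero: "0 \<notin> R"
    and refl: "\<And>\<alpha> \<beta>. \<alpha> \<in> R \<Longrightarrow> \<beta> \<in> R \<Longrightarrow> reflection \<alpha> \<beta> \<in> R"
    using R unfolding crystallographic_root_system_def by blast+
  have sub: "\<Delta> \<subseteq> R" and ind: "independent \<Delta>"
    and pm: "\<And>\<beta>. \<beta> \<in> R \<Longrightarrow> nonneg_combination \<Delta> \<beta> \<or> nonneg_combination \<Delta> (- \<beta>)"
    using \<Delta> unfolding simple_roots_def by blast+
  have fin: "finite \<Delta>" using finR sub finite_subset by blast
  have neg: "- \<gamma> \<in> R" if "\<gamma> \<in> R" for \<gamma>
    using refl[OF that that] reflection_root[of \<gamma>] zero that by metis
  \<comment> \<open>Induction on the height \<open>sum c \<Delta>\<close> of a positive root.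
    Treating \<beta> and its negative together settles the negative roots at the same time.\<close>
  have pos: "P \<beta> \<and> P (- \<beta>)" if "\<beta> \<in> R" "\<beta> = (\<Sum>\<alpha>\<in>\<Delta>. real (c \<alpha>) *\<^sub>R \<alpha>)" for \<beta> c
    using that
  proof (induction "sum c \<Delta>" arbitrary: c \<beta> rule: less_induct)
    case less
    \<comment> \<open>Expanding only one factor of the squared length in simple roots gives a
      positive sum, so some summand is positive. As \<open>c \<alpha>\<close> is nonnegative, this
      forces a positive scalar product of \<beta> with \<alpha>.\<close>
    have "0 < \<beta> \<bullet> \<beta>" using less.prems(1) zero by auto
    also have "\<beta> \<bullet> \<beta> = (\<Sum>\<alpha>\<in>\<Delta>. real (c \<alpha>) * (\<beta> \<bullet> \<alpha>))"
      by (subst (2) less.prems(2)) (simp add: inner_sum_right)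
    finally have "\<not> (\<forall>\<alpha>\<in>\<Delta>. real (c \<alpha>) * (\<beta> \<bullet> \<alpha>) \<le> 0)"
      using sum_nonpos by (metis (no_types, lifting) not_less)
    then obtain \<alpha> where \<alpha>: "\<alpha> \<in> \<Delta>" and "0 < real (c \<alpha>) * (\<beta> \<bullet> \<alpha>)"
      by (auto simp: not_le)
    then have pr: "0 < \<beta> \<bullet> \<alpha>" by (simp add: zero_less_mult_iff)
    have \<alpha>R: "\<alpha> \<in> R" and \<alpha>0: "\<alpha> \<noteq> 0" using \<alpha> sub zero by auto
    define k where "k = \<beta> \<bullet> coroot \<alpha>"
    have "k > 0" using pr \<alpha>0 by (simp add: k_def coroot_def)
    define \<gamma> where "\<gamma> = reflection \<alpha> \<beta>"
    have \<gamma>R: "\<gamma> \<in> R" using refl \<alpha>R less.prems(1) by (simp add: \<gamma>_def)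
    have "\<gamma> = \<beta> - k *\<^sub>R \<alpha>" by (simp add: \<gamma>_def reflection_def k_def)
    also have "k *\<^sub>R \<alpha> = (\<Sum>\<delta>\<in>\<Delta>. (if \<delta> = \<alpha> then k else 0) *\<^sub>R \<delta>)"
      using fin \<alpha> by (simp add: if_distrib[of "\<lambda>u. u *\<^sub>R _"] cong: if_cong)
    finally have \<gamma>_sum: "\<gamma> = (\<Sum>\<delta>\<in>\<Delta>. (real (c \<delta>) - (if \<delta> = \<alpha> then k else 0)) *\<^sub>R \<delta>)"
      by (simp add: less.prems(2) scaleR_left_diff_distrib sum_subtractf)
    have \<beta>_eq: "\<beta> = reflection \<alpha> \<gamma>" "- \<beta> = reflection \<alpha> (- \<gamma>)"
      by (simp_all add: \<gamma>_def reflection_involutive \<alpha>0 linear_neg[OF linear_reflection])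
    from pm[OF \<gamma>R] show ?case
    proof
      assume "nonneg_combination \<Delta> \<gamma>"
      then obtain d where d: "\<gamma> = (\<Sum>\<delta>\<in>\<Delta>. real (d \<delta>) *\<^sub>R \<delta>)"
        unfolding nonneg_combination_def by blast
      have eq: "real (d \<delta>) = real (c \<delta>) - (if \<delta> = \<alpha> then k else 0)" if "\<delta> \<in> \<Delta>" for \<delta>
        by (rule independent_sum_eqD[OF fin ind _ that]) (use d \<gamma>_sum in simp)
      \<comment> \<open>The reflection changes only the coordinate at \<alpha>, lowering it by k >
        0, so the height drops strictly.\<close>
      have "sum d \<Delta> < sum c \<Delta>"
      proof (rule sum_strict_mono_ex1[OF fin])
        show "\<forall>\<delta>\<in>\<Delta>. d \<delta> \<le> c \<delta>"
          using eq \<open>k > 0\<close> by (smt (verit) of_nat_le_iff)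
        show "\<exists>\<delta>\<in>\<Delta>. d \<delta> < c \<delta>"
          using eq[OF \<alpha>] \<open>k > 0\<close> \<alpha> by (intro bexI[of _ \<alpha>]) auto
      qed
      then have "P \<gamma> \<and> P (- \<gamma>)" using less.hyps \<gamma>R d by blast
      then show ?thesis using reflect[OF \<alpha>] \<gamma>R neg \<beta>_eq by metis
    next
      assume "nonneg_combination \<Delta> (- \<gamma>)"
      then obtain d where d: "- \<gamma> = (\<Sum>\<delta>\<in>\<Delta>. real (d \<delta>) *\<^sub>R \<delta>)"
        unfolding nonneg_combination_def by blast
      then have d': "\<gamma> = (\<Sum>\<delta>\<in>\<Delta>. (- real (d \<delta>)) *\<^sub>R \<delta>)"
        by (metis (no_types, lifting) minus_minus scaleR_minus_left sum.cong sum_negf)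
      \<comment> \<open>Away from \<alpha> the coordinate of \<gamma> is still that of \<beta>, so
        it is both nonpositive and nonnegative and hence zero. Thus \<beta> is a multiple of
        \<alpha>, and reducedness together with the nonnegative coefficient leaves only \<beta> =
        \<alpha>; its negative is the reflection of \<alpha> in itself.\<close>
      have "- real (d \<delta>) = real (c \<delta>) - (if \<delta> = \<alpha> then k else 0)" if "\<delta> \<in> \<Delta>" for \<delta>
        by (rule independent_sum_eqD[OF fin ind _ that]) (use d' \<gamma>_sum in simp)
      then have "c \<delta> = 0" if "\<delta> \<in> \<Delta>" "\<delta> \<noteq> \<alpha>" for \<delta>
        using that by fastforce
      then have "\<beta> = (\<Sum>\<delta>\<in>\<Delta>. if \<delta> = \<alpha> then real (c \<alpha>) *\<^sub>R \<alpha> else 0)"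
        unfolding less.prems(2) by (intro sum.cong) auto
      then have \<beta>c: "\<beta> = real (c \<alpha>) *\<^sub>R \<alpha>" using fin \<alpha> by simp
      then have "real (c \<alpha>) = 1 \<or> real (c \<alpha>) = -1"
        using red \<alpha>R less.prems(1) unfolding reduced_roots_def by metis
      then have "\<beta> = \<alpha>" using \<beta>c by auto
      then show ?thesis
        using simple[OF \<alpha>] reflect[OF \<alpha> \<alpha>R] by (simp add: reflection_root[OF \<alpha>0])
    qed
  qed
  from pm[OF \<open>\<beta> \<in> R\<close>] show ?thesis
  proof
    assume "nonneg_combination \<Delta> \<beta>"
    then show ?thesis using pos \<open>\<beta> \<in> R\<close> unfolding nonneg_combination_def by blast
  next
    assume "nonneg_combination \<Delta> (- \<beta>)"
    then obtain c where "- \<beta> = (\<Sum>\<alpha>\<in>\<Delta>. real (c \<alpha>) *\<^sub>R \<alpha>)"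
      unfolding nonneg_combination_def by blast
    then have "P (- (- \<beta>))" using pos neg[OF \<open>\<beta> \<in> R\<close>] by blast
    then show ?thesis by simp
  qed
qed

section \<open>Reflections in arbitrary roots belong to the Weyl group\<close>

lemma weyl_group_comp:
  assumes "0 \<notin> \<Delta>" and "v \<in> weyl_group \<Delta>" and "w \<in> weyl_group \<Delta>"
  shows "v \<circ> w \<in> weyl_group \<Delta>"
proof -
  have "\<forall>h\<in>reflection ` \<Delta>. bij h"
    using assms(1) bij_reflection by (metis imageE)
  then have "bij v" and "bij w"
    using assms(2,3) generate_BijGroup_bij unfolding weyl_group_def by blast+
  then show ?thesis
    using generate.eng[OF assms(2,3)[unfolded weyl_group_def]]
    by (simp only: weyl_group_def mult_BijGroup_UNIV)
qed

lemma reflection_in_weyl_group: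
  assumes R: "crystallographic_root_system R" and "reduced_roots R"
    and \<Delta>: "simple_roots R \<Delta>" and "\<beta> \<in> R"
  shows "reflection \<beta> \<in> weyl_group \<Delta>"
  using assms
proof (induction rule: root_induct)
  case (simple \<alpha>)
  then show ?case by (simp add: weyl_group_def generate.incl)
next
  case (reflect \<alpha> \<beta>)
  have "0 \<notin> \<Delta>"
    using R \<Delta> unfolding crystallographic_root_system_def simple_roots_def by blast
  moreover have "reflection \<alpha> \<in> weyl_group \<Delta>"
    using reflect.hyps(1) by (simp add: weyl_group_def generate.incl)
  ultimately have "reflection \<alpha> \<circ> reflection \<beta> \<circ> reflection \<alpha> \<in> weyl_group \<Delta>"
    by (intro weyl_group_comp reflect.IH)
  moreover have "\<alpha> \<noteq> 0"
    using \<open>0 \<notin> \<Delta>\<close> reflect.hyps(1) by blast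
  ultimately show ?case
    by (metis reflection_reflection)
qed

section \<open>Integrality of weights on all coroots\<close>

lemma weight_lattice_reflection:
  assumes R: "crystallographic_root_system R" and \<Delta>: "simple_roots R \<Delta>"
    and \<alpha>: "\<alpha> \<in> \<Delta>" and \<mu>: "\<mu> \<in> weight_lattice \<Delta>"
  shows "reflection \<alpha> \<mu> \<in> weight_lattice \<Delta>"
proof -
  \<comment> \<open>The reflection subtracts an integer multiple of \<alpha>, so it is enough that
    \<alpha> is itself a weight, which is the crystallographic condition.\<close>
  have "\<alpha> \<bullet> coroot \<beta> \<in> \<int>" if "\<beta> \<in> \<Delta>" for \<beta>
    using R \<Delta> \<alpha> that unfolding crystallographic_root_system_def simple_roots_def by blast
  then show ?thesis
    using \<mu> \<alpha> by (simp add: weight_lattice_def reflection_def inner_diff_left)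
qed

lemma weight_inner_coroot_Ints:
  assumes R: "crystallographic_root_system R" and "reduced_roots R"
    and \<Delta>: "simple_roots R \<Delta>" and "\<beta> \<in> R" and "\<mu> \<in> weight_lattice \<Delta>"
  shows "\<mu> \<bullet> coroot \<beta> \<in> \<int>"
proof -
  \<comment> \<open>The weight is quantified inside the induction because self-adjointness moves the
    simple reflection from the coroot to \<mu>; the induction hypothesis is then used at the
    reflected weight.\<close>
  have "\<forall>\<mu>\<in>weight_lattice \<Delta>. \<mu> \<bullet> coroot \<beta> \<in> \<int>"
    using assms(1-4)
  proof (induction rule: root_induct)
    case (simple \<alpha>)
    then show ?case by (simp add: weight_lattice_def)
  next
    case (reflect \<alpha> \<beta>)
    have "\<alpha> \<noteq> 0"
      using R \<Delta> reflect.hyps(1)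
      unfolding crystallographic_root_system_def simple_roots_def by blast
    then show ?case
      using reflect.IH weight_lattice_reflection[OF R \<Delta> reflect.hyps(1)]
      by (simp add: coroot_reflection reflection_self_adjoint)
  qed
  then show ?thesis using assms(5) by blast
qed

lemma weyl_orbit_subset_weight_lattice:
  assumes R: "crystallographic_root_system R" and \<Delta>: "simple_roots R \<Delta>"
    and "v \<in> weight_lattice \<Delta>"
  shows "weyl_orbit \<Delta> v \<subseteq> weight_lattice \<Delta>"
proof -
  have 0: "0 \<notin> \<Delta>"
    using R \<Delta> unfolding crystallographic_root_system_def simple_roots_def by blast
  then have bij: "\<forall>h\<in>reflection ` \<Delta>. bij h"
    using bij_reflection by (metis imageE)
  have "\<forall>\<mu>\<in>weight_lattice \<Delta>. w \<mu> \<in> weight_lattice \<Delta>" if "w \<in> weyl_group \<Delta>" for w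
    using that[unfolded weyl_group_def] bij
  proof (induction rule: generate_BijGroup_induct)
    case (inv h)
    then obtain \<alpha> where "\<alpha> \<in> \<Delta>" "h = reflection \<alpha>" by blast
    moreover from this have "\<alpha> \<noteq> 0" using 0 by blast
    ultimately show ?case
      using weight_lattice_reflection[OF R \<Delta>] by (simp add: inv_reflection)
  qed (use weight_lattice_reflection[OF R \<Delta>] in auto)
  then show ?thesis using assms(3) by (auto simp: weyl_orbit_def)
qed

section \<open>Symmetries of orbit functions\<close>

lemma orbit_function_reflection:
  assumes "0 \<notin> \<Delta>" and "\<beta> \<noteq> 0" and "reflection \<beta> \<in> weyl_group \<Delta>"
  shows "orbit_function \<Delta> v (reflection \<beta> x) = orbit_function \<Delta> v x"
proof -
  have maps: "reflection \<beta> \<mu> \<in> weyl_orbit \<Delta> v" if \<mu>: "\<mu> \<in> weyl_orbit \<Delta> v" for \<mu>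
  proof -
    obtain w where "w \<in> weyl_group \<Delta>" and w: "\<mu> = w v"
      using \<mu> by (auto simp: weyl_orbit_def)
    then have "reflection \<beta> \<circ> w \<in> weyl_group \<Delta>"
      using weyl_group_comp[OF assms(1,3)] by blast
    moreover have "reflection \<beta> \<mu> = (reflection \<beta> \<circ> w) v" by (simp add: w)
    ultimately show ?thesis unfolding weyl_orbit_def by blast
  qed
  show ?thesis
    unfolding orbit_function_def
    \<comment> \<open>Self-adjointness moves the reflection from x to the summation index \<mu>. It
      permutes the orbit and, as an involution, serves as its own inverse in the reindexing.\<close>
    by (rule sum.reindex_bij_witness[of _ "reflection \<beta>" "reflection \<beta>"])
      (simp_all add: maps reflection_involutive assms(2) reflection_self_adjoint)
qed

lemma orbit_function_translation:
  assumes "\<And>\<mu>. \<mu> \<in> weyl_orbit \<Delta> v \<Longrightarrow> \<mu> \<bullet> t \<in> \<int>"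
  shows "orbit_function \<Delta> v (x + t) = orbit_function \<Delta> v x"
  unfolding orbit_function_def
proof (rule sum.cong[OF refl])
  fix \<mu> assume "\<mu> \<in> weyl_orbit \<Delta> v"
  then obtain m where "\<mu> \<bullet> t = of_int m" using assms Ints_cases by metis
  \<comment> \<open>The extra term is put into the form of the periods in \<open>exp_eq\<close>,
    with the integer m as witness.\<close>
  then have "2 * of_real pi * \<i> * of_real (\<mu> \<bullet> (x + t))
      = 2 * of_real pi * \<i> * of_real (\<mu> \<bullet> x) + of_real (of_int (2 * m) * pi) * \<i>"
    by (simp add: inner_add_right algebra_simps)
  then show "exp (2 * of_real pi * \<i> * of_real (\<mu> \<bullet> (x + t)))
      = exp (2 * of_real pi * \<i> * of_real (\<mu> \<bullet> x))"
    unfolding exp_eq by (intro exI[of _ m])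
qed

lemma bij_affine_reflection:
  assumes "\<xi> \<noteq> 0"
  shows "bij (affine_reflection \<xi>)"
proof -
  have "affine_reflection \<xi> = (\<lambda>x. x + coroot \<xi>) \<circ> reflection \<xi>"
    by (simp add: fun_eq_iff affine_reflection_def)
  then show ?thesis
    using bij_comp[OF bij_reflection[OF assms]] bij_plus_right by metis
qed

theorem mainTheorem1:
  fixes R \<Delta> :: "'a::euclidean_space set"
  assumes "crystallographic_root_system R" and "reduced_roots R" and "irreducible_roots R"
    and "normalized_roots R"
    and "simple_roots R \<Delta>"
  shows "(\<forall>v\<in>dominant_chamber \<Delta>. \<forall>w\<in>weyl_group \<Delta>. \<forall>x.
            orbit_function \<Delta> v (w x) = orbit_function \<Delta> v x) \<and>
         (\<forall>\<xi>. highest_root R \<Delta> \<xi> \<longrightarrow>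
            (\<forall>v\<in>dominant_weights \<Delta>. \<forall>g\<in>affine_weyl_group \<Delta> \<xi>. \<forall>x.
               orbit_function \<Delta> v (g x) = orbit_function \<Delta> v x))"
proof (intro conjI allI impI ballI)
  have 0: "0 \<notin> R" and sub: "\<Delta> \<subseteq> R"
    using assms unfolding crystallographic_root_system_def simple_roots_def by blast+
  \<comment> \<open>This is stated for all roots rather than simple ones because the linear part of
    the affine generator is the reflection in \<xi>, which need not be simple.\<close>
  have root: "orbit_function \<Delta> v (reflection \<beta> x) = orbit_function \<Delta> v x" if "\<beta> \<in> R" for v \<beta> x
    using 0 sub that reflection_in_weyl_group[OF assms(1,2,5) that]
    by (intro orbit_function_reflection) auto
  have bij: "bij (reflection \<beta>)" if "\<beta> \<in> R" for \<beta>
    by (rule bij_reflection) (use 0 that in auto)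
  show "orbit_function \<Delta> v (w x) = orbit_function \<Delta> v x" if "w \<in> weyl_group \<Delta>" for v w x
    by (rule generate_BijGroup_invariant[where f = "orbit_function \<Delta> v",
          OF that[unfolded weyl_group_def]])
      (auto intro: bij simp: root subsetD[OF sub])
  fix \<xi> v g x
  assume "highest_root R \<Delta> \<xi>" and v: "v \<in> dominant_weights \<Delta>"
    and g: "g \<in> affine_weyl_group \<Delta> \<xi>"
  then have \<xi>: "\<xi> \<in> R" by (simp add: highest_root_def)
  have "weyl_orbit \<Delta> v \<subseteq> weight_lattice \<Delta>"
    using weyl_orbit_subset_weight_lattice[OF assms(1,5)] v by (simp add: dominant_weights_def)
  then have "\<mu> \<bullet> coroot \<xi> \<in> \<int>" if "\<mu> \<in> weyl_orbit \<Delta> v" for \<mu>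
    using weight_inner_coroot_Ints[OF assms(1,2,5) \<xi>] that by blast
  \<comment> \<open>Integrality on the orbit removes the translation by the coroot of \<xi>, and the
    remaining reflection is covered by \<open>root\<close>.\<close>
  then have "orbit_function \<Delta> v (affine_reflection \<xi> y) = orbit_function \<Delta> v y" for y
    by (simp add: affine_reflection_def orbit_function_translation root[OF \<xi>])
  moreover have "bij (affine_reflection \<xi>)"
    by (rule bij_affine_reflection) (use 0 \<xi> in auto)
  ultimately show "orbit_function \<Delta> v (g x) = orbit_function \<Delta> v x"
    by (intro generate_BijGroup_invariant[where f = "orbit_function \<Delta> v",
          OF g[unfolded affine_weyl_group_def]])
      (auto intro: bij simp: root subsetD[OF sub])
qed

end
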